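(* Let $\gamma:\mathbb{S}\to\mathbb{R}^2$ be defined by $$\gamma(u)=\frac{1}{1+\sin^2u}\left(\cos u,\ \tfrac12\sin 2u\right).$$ Then $\gamma$ evolves self-similarly (homothetically) under the curve diffusion flow.
   Context: $\mathbb{S}=\mathbb{R}/2\pi\mathbb{Z}$. For a smooth regular plane curve, $s$ is arc length, $\nu$ a smooth unit normal field, and $\kappa=\langle\gamma_{ss},\nu\rangle$. A family of curves $\gamma(\cdot,t)$ evolves by the curve diffusion flow if $\langle\partial_t\gamma,\nu\rangle=-\kappa_{ss}$ (the flow is considered up to tangential reparametrisation). A curve $\gamma$ evolves self-similarly (homothetically) if there are $T>0$ and a positive differentiable function $f:[0,T)\to\mathbb{R}$ with $f(0)=1$ such that $\gamma(u,t)=f(t)\gamma(u)$ satisfies the curve diffusion flow on $[0,T)$. *)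

theory Defs
  imports "HOL-Analysis.Analysis"
begin

text \<open>Maps on the circle of length \<open>2 * pi\<close> are rendered as \<open>2 * pi\<close>-periodic maps on the real line.\<close>

definition smooth :: "(real \<Rightarrow> 'a::real_normed_vector) \<Rightarrow> bool" where
  "smooth c \<longleftrightarrow> (\<forall>n. ((\<lambda>g u. vector_derivative g (at u)) ^^ n) c differentiable_on UNIV)"

definition periodic_2pi :: "(real \<Rightarrow> 'a) \<Rightarrow> bool" where
  "periodic_2pi c \<longleftrightarrow> (\<forall>u. c (u + 2 * pi) = c u)"

definition regular_closed_curve :: "(real \<Rightarrow> real \<times> real) \<Rightarrow> bool" where
  "regular_closed_curve \<gamma> \<longleftrightarrow>
     smooth \<gamma> \<and> periodic_2pi \<gamma> \<and> (\<forall>u. vector_derivative \<gamma> (at u) \<noteq> 0)"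

text \<open>The derivative of \<open>\<phi>\<close> with respect to the arc length of \<open>\<gamma>\<close>, expressed in the
  given parameter \<open>u\<close> by the chain rule: \<open>\<phi>\<^sub>s = \<phi>\<^sub>u / |\<gamma>\<^sub>u|\<close>.\<close>

definition arclength_deriv ::
  "(real \<Rightarrow> real \<times> real) \<Rightarrow> (real \<Rightarrow> 'a::real_normed_vector) \<Rightarrow> real \<Rightarrow> 'a" where
  "arclength_deriv \<gamma> \<phi> u =
     vector_derivative \<phi> (at u) /\<^sub>R norm (vector_derivative \<gamma> (at u))"

definition unit_normal_field :: "(real \<Rightarrow> real \<times> real) \<Rightarrow> (real \<Rightarrow> real \<times> real) \<Rightarrow> bool" where
  "unit_normal_field \<gamma> \<nu> \<longleftrightarrow> smooth \<nu> \<and> periodic_2pi \<nu> \<and>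
     (\<forall>u. norm (\<nu> u) = 1 \<and> \<nu> u \<bullet> vector_derivative \<gamma> (at u) = 0)"

definition curvature ::
  "(real \<Rightarrow> real \<times> real) \<Rightarrow> (real \<Rightarrow> real \<times> real) \<Rightarrow> real \<Rightarrow> real" where
  "curvature \<gamma> \<nu> u = arclength_deriv \<gamma> (arclength_deriv \<gamma> \<gamma>) u \<bullet> \<nu> u"

text \<open>Only the normal component of the velocity is prescribed. Replacing the normal field of a
  time slice by its negative changes the sign of both sides of the equation, so it does not
  matter which unit normal field is chosen. The time derivative is one-sided at \<open>0\<close>.\<close>

definition curve_diffusion_flow :: "real \<Rightarrow> (real \<Rightarrow> real \<Rightarrow> real \<times> real) \<Rightarrow> bool" where
  "curve_diffusion_flow T \<Gamma> \<longleftrightarrow>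
     (\<forall>t\<in>{0..<T}. regular_closed_curve (\<lambda>u. \<Gamma> u t) \<and>
       (\<exists>\<nu>. unit_normal_field (\<lambda>u. \<Gamma> u t) \<nu> \<and>
         (\<forall>u. \<exists>v. ((\<lambda>\<tau>. \<Gamma> u \<tau>) has_vector_derivative v) (at t within {0..<T}) \<and>
            v \<bullet> \<nu> u =
              - arclength_deriv (\<lambda>u. \<Gamma> u t)
                  (arclength_deriv (\<lambda>u. \<Gamma> u t) (curvature (\<lambda>u. \<Gamma> u t) \<nu>)) u)))"

definition evolves_homothetically :: "(real \<Rightarrow> real \<times> real) \<Rightarrow> bool" where
  "evolves_homothetically \<gamma> \<longleftrightarrow>
     (\<exists>T>0. \<exists>f::real \<Rightarrow> real.
        (\<forall>t\<in>{0..<T}. f t > 0) \<and> f differentiable_on {0..<T} \<and> f 0 = 1 \<and>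
        curve_diffusion_flow T (\<lambda>u t. f t *\<^sub>R \<gamma> u))"

end

theory Submission
  imports Defs
begin

text \<open>
  Identify the plane with the complex numbers and write \<open>s = sin u\<close>, \<open>c = cos u\<close>,
  \<open>p = (1 + s\<^sup>2) powr (- 1 / 2)\<close>. The lemniscate is \<open>\<gamma> = c p\<^sup>2 (1 + i s)\<close>, its speed is \<open>p\<close>, and
  its unit tangent is \<open>i ((1 + i s) p)\<^sup>3\<close>. Hence, for the normal \<open>\<nu> = - ((1 + i s) p)\<^sup>3\<close>,
  \<open>\<kappa> = 3 c p\<close> and \<open>\<kappa>\<^sub>s\<^sub>s = - 6 c\<^sup>3 p\<^sup>3 = 6 \<langle>\<gamma>, \<nu>\<rangle>\<close>. Under scaling by \<open>f\<close>, \<open>\<kappa>\<^sub>s\<^sub>s\<close> scales like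
  \<open>f powr (- 3)\<close>, so the flow reduces to \<open>f' = - 6 / f\<^sup>3\<close>, which \<open>f = (1 - 24 t) powr (1 / 4)\<close> solves.
\<close>

section \<open>A criterion for smoothness\<close>

text \<open>By induction on the order, every iterated derivative of \<open>c\<close> stays in
  \<open>P\<close>, and members of \<open>P\<close> are differentiable. No formula for higher
  derivatives is needed.\<close>

lemma smooth_coinduct:
  assumes "P c"
    and step: "\<And>g. P g \<Longrightarrow> \<exists>g'. P g' \<and> (\<forall>u. (g has_vector_derivative g' u) (at u))"
  shows "smooth c"
proof -
  have deriv: "P (\<lambda>u. vector_derivative g (at u)) \<and> g differentiable_on UNIV" if Pg: "P g" for g
  proof -
    obtain g' where g': "P g'" "\<And>u. (g has_vector_derivative g' u) (at u)"
      using step[OF Pg] by blast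
    then have "(\<lambda>u. vector_derivative g (at u)) = g'"
      by (auto intro: vector_derivative_at)
    moreover have "g differentiable_on UNIV"
      using g'(2) by (auto simp: differentiable_on_def has_vector_derivative_def differentiable_def)
    ultimately show ?thesis
      using g'(1) by simp
  qed
  have "P (((\<lambda>g u. vector_derivative g (at u)) ^^ n) c)" for n
    using \<open>P c\<close> deriv by (induction n) auto
  then show ?thesis
    using deriv by (simp add: smooth_def)
qed

section \<open>The speed function and the ring it generates with sine and cosine\<close>

definition speed :: "real \<Rightarrow> real" where
  "speed u = 1 / sqrt (1 + (sin u)\<^sup>2)"

lemma one_plus_sin_square_pos: "1 + (sin u)\<^sup>2 > (0::real)"
  by (simp add: add_pos_nonneg)

lemma speed_pos: "speed u > 0"
  using one_plus_sin_square_pos by (simp add: speed_def)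

lemma speed_square: "(speed u)\<^sup>2 = 1 / (1 + (sin u)\<^sup>2)"
  using one_plus_sin_square_pos[of u] by (simp add: speed_def power_divide)

text \<open>Free of roots and divisions, this form together with the Pythagorean identity lets
  \<open>algebra\<close> settle the later claims as polynomial identities.\<close>

lemma speed_relation: "(speed u)\<^sup>2 * (1 + (sin u)\<^sup>2) = 1"
  using one_plus_sin_square_pos[of u] by (simp add: speed_square)

lemma has_real_derivative_speed:
  "(speed has_real_derivative - (sin u * cos u * speed u ^ 3)) (at u)"
proof -
  have "(speed has_real_derivative
      - (inverse (sqrt (1 + (sin u)\<^sup>2)) / 2 * (2 * sin u * cos u)) / (sqrt (1 + (sin u)\<^sup>2))\<^sup>2) (at u)"
    unfolding speed_def
    using one_plus_sin_square_pos[of u]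
    by (auto intro!: derivative_eq_intros simp: power2_eq_square)
  then show ?thesis
    by (simp add: speed_def field_simps power2_eq_square power3_eq_cube)
qed

text \<open>Closure under differentiation becomes a rule induction. \<open>speed\<close> can be a
  generator because its derivative is again a polynomial in the generators.\<close>

inductive trig_algebra :: "(real \<Rightarrow> real) \<Rightarrow> bool" where
  const: "trig_algebra (\<lambda>u. a)"
| sin: "trig_algebra sin"
| cos: "trig_algebra cos"
| speed: "trig_algebra speed"
| add: "trig_algebra f \<Longrightarrow> trig_algebra g \<Longrightarrow> trig_algebra (\<lambda>u. f u + g u)"
| mult: "trig_algebra f \<Longrightarrow> trig_algebra g \<Longrightarrow> trig_algebra (\<lambda>u. f u * g u)"

lemma trig_algebra_uminus: "trig_algebra f \<Longrightarrow> trig_algebra (\<lambda>u. - f u)"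
  using trig_algebra.mult[OF trig_algebra.const[of "-1"]] by simp

lemma trig_algebra_diff: "trig_algebra f \<Longrightarrow> trig_algebra g \<Longrightarrow> trig_algebra (\<lambda>u. f u - g u)"
  using trig_algebra.add[OF _ trig_algebra_uminus] by simp

lemma trig_algebra_power: "trig_algebra f \<Longrightarrow> trig_algebra (\<lambda>u. f u ^ n)"
  by (induction n) (auto intro: trig_algebra.intros)

lemmas trig_algebra_intros =
  trig_algebra.intros trig_algebra_uminus trig_algebra_diff trig_algebra_power

lemma trig_algebra_has_derivative:
  assumes "trig_algebra f"
  shows "\<exists>f'. trig_algebra f' \<and> (\<forall>u. (f has_real_derivative f' u) (at u))"
  using assms
proof induction
  case (const a)
  show ?case by (intro exI[of _ "\<lambda>u. 0"]) (auto intro: trig_algebra.intros)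
next
  case sin
  show ?case by (intro exI[of _ cos]) (auto intro: trig_algebra.intros)
next
  case cos
  show ?case
    by (intro exI[of _ "\<lambda>u. - sin u"])
      (auto intro!: trig_algebra_intros derivative_eq_intros)
next
  case speed
  show ?case
    by (intro exI[of _ "\<lambda>u. - (sin u * cos u * speed u ^ 3)"])
      (auto intro!: trig_algebra_intros has_real_derivative_speed)
next
  case (add f g)
  then obtain f' g' where "trig_algebra f'" "trig_algebra g'"
    "\<And>u. (f has_real_derivative f' u) (at u)" "\<And>u. (g has_real_derivative g' u) (at u)"
    by blast
  then show ?case
    by (intro exI[of _ "\<lambda>u. f' u + g' u"])
      (auto intro!: trig_algebra_intros derivative_eq_intros)
next
  case (mult f g)
  then obtain f' g' where "trig_algebra f'" "trig_algebra g'"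
    "\<And>u. (f has_real_derivative f' u) (at u)" "\<And>u. (g has_real_derivative g' u) (at u)"
    by blast
  with mult.hyps show ?case
    by (intro exI[of _ "\<lambda>u. f' u * g u + f u * g' u"])
      (auto intro!: trig_algebra_intros derivative_eq_intros)
qed

lemma has_vector_derivative_Pair_real:
  assumes "(f has_real_derivative f') (at u)" "(g has_real_derivative g') (at u)"
  shows "((\<lambda>u. (f u, g u)) has_vector_derivative (f', g')) (at u)"
  using assms by (auto intro!: has_vector_derivative_Pair
      simp: has_real_derivative_iff_has_vector_derivative)

text \<open>Pairs with both components in \<open>trig_algebra\<close> form a class closed under
  differentiation, as \<open>smooth_coinduct\<close> requires.\<close>

lemma smooth_trig_algebra_Pair:
  assumes "trig_algebra f" "trig_algebra g"
  shows "smooth (\<lambda>u. (f u, g u))"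
proof (rule smooth_coinduct[where P = "\<lambda>h. \<exists>f g. trig_algebra f \<and> trig_algebra g \<and> h = (\<lambda>u. (f u, g u))"])
  show "\<exists>f' g'. trig_algebra f' \<and> trig_algebra g' \<and> (\<lambda>u. (f u, g u)) = (\<lambda>u. (f' u, g' u))"
    using assms by blast
next
  fix h :: "real \<Rightarrow> real \<times> real"
  assume "\<exists>f g. trig_algebra f \<and> trig_algebra g \<and> h = (\<lambda>u. (f u, g u))"
  then obtain f g where fg: "trig_algebra f" "trig_algebra g" and h: "h = (\<lambda>u. (f u, g u))"
    by blast
  obtain f' g' where "trig_algebra f'" "trig_algebra g'"
    "\<And>u. (f has_real_derivative f' u) (at u)" "\<And>u. (g has_real_derivative g' u) (at u)"
    using fg[THEN trig_algebra_has_derivative] by blast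
  then show "\<exists>h'. (\<exists>f g. trig_algebra f \<and> trig_algebra g \<and> h' = (\<lambda>u. (f u, g u))) \<and>
      (\<forall>u. (h has_vector_derivative h' u) (at u))"
    by (intro exI[of _ "\<lambda>u. (f' u, g' u)"]) (auto simp: h intro!: has_vector_derivative_Pair_real)
qed

section \<open>The lemniscate and its moving frame\<close>

definition lemniscate :: "real \<Rightarrow> real \<times> real" where
  "lemniscate u = (cos u * (speed u)\<^sup>2, sin u * cos u * (speed u)\<^sup>2)"

text \<open>Real and imaginary part of \<open>i z^3\<close>, where
  \<open>z = (1 + i sin u) * speed u\<close> lies on the unit circle.\<close>

definition lemniscate_tangent :: "real \<Rightarrow> real \<times> real" where
  "lemniscate_tangent u =
     (- (sin u * (3 - (sin u)\<^sup>2) * speed u ^ 3), (1 - 3 * (sin u)\<^sup>2) * speed u ^ 3)"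

definition lemniscate_normal :: "real \<Rightarrow> real \<times> real" where
  "lemniscate_normal u =
     (- ((1 - 3 * (sin u)\<^sup>2) * speed u ^ 3), - (sin u * (3 - (sin u)\<^sup>2) * speed u ^ 3))"

text \<open>In complex form the curve is \<open>cos u / (1 - i sin u)\<close>. The quotient rule
  leaves \<open>i - sin u = i (1 + i sin u)\<close> over \<open>(1 - i sin u)^2\<close>.\<close>

lemma has_vector_derivative_lemniscate:
  "(lemniscate has_vector_derivative speed u *\<^sub>R lemniscate_tangent u) (at u)"
proof -
  note rel = speed_relation[of u] sin_cos_squared_add[of u]
  have 1: "((\<lambda>u. cos u * (speed u)\<^sup>2) has_real_derivative
      speed u * (- (sin u * (3 - (sin u)\<^sup>2) * speed u ^ 3))) (at u)"
    apply (rule derivative_eq_intros has_real_derivative_speed refl)+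
    apply simp
    using rel apply algebra
    done
  have 2: "((\<lambda>u. sin u * cos u * (speed u)\<^sup>2) has_real_derivative
      speed u * ((1 - 3 * (sin u)\<^sup>2) * speed u ^ 3)) (at u)"
    apply (rule derivative_eq_intros has_real_derivative_speed refl)+
    apply simp
    using rel apply algebra
    done
  show ?thesis
    using has_vector_derivative_Pair_real[OF 1 2]
    by (simp add: lemniscate_def[abs_def] lemniscate_tangent_def)
qed

text \<open>The argument of \<open>z\<close> is \<open>arctan (sin u)\<close>, with derivative
  \<open>cos u * (speed u)^2\<close>; cubing \<open>z\<close> triples this rate of rotation.\<close>

lemma has_vector_derivative_lemniscate_tangent:
  "(lemniscate_tangent has_vector_derivative (3 * cos u * (speed u)\<^sup>2) *\<^sub>R lemniscate_normal u) (at u)"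
proof -
  note rel = speed_relation[of u] sin_cos_squared_add[of u]
  have 1: "((\<lambda>u. - (sin u * (3 - (sin u)\<^sup>2) * speed u ^ 3)) has_real_derivative
      3 * cos u * (speed u)\<^sup>2 * (- ((1 - 3 * (sin u)\<^sup>2) * speed u ^ 3))) (at u)"
    apply (rule derivative_eq_intros has_real_derivative_speed refl)+
    apply simp
    using rel apply algebra
    done
  have 2: "((\<lambda>u. (1 - 3 * (sin u)\<^sup>2) * speed u ^ 3) has_real_derivative
      3 * cos u * (speed u)\<^sup>2 * (- (sin u * (3 - (sin u)\<^sup>2) * speed u ^ 3))) (at u)"
    apply (rule derivative_eq_intros has_real_derivative_speed refl)+
    apply simp
    using rel apply algebra
    done
  show ?thesis
    using has_vector_derivative_Pair_real[OF 1 2]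
    by (simp add: lemniscate_normal_def lemniscate_tangent_def[abs_def])
qed

text \<open>This is \<open>|z^3| = 1\<close>, resting on
  \<open>(1 - 3 x)^2 + x (3 - x)^2 = (1 + x)^3\<close> for \<open>x = (sin u)^2\<close>.\<close>

lemma norm_lemniscate_normal: "norm (lemniscate_normal u) = 1"
proof -
  have "((1 - 3 * (sin u)\<^sup>2) * speed u ^ 3)\<^sup>2 + (sin u * (3 - (sin u)\<^sup>2) * speed u ^ 3)\<^sup>2 = 1"
    using speed_relation[of u] by algebra
  then show ?thesis
    by (simp add: lemniscate_normal_def norm_Pair)
qed

lemma norm_lemniscate_tangent: "norm (lemniscate_tangent u) = 1"
  using norm_lemniscate_normal[of u]
  by (simp add: lemniscate_normal_def lemniscate_tangent_def norm_Pair add.commute)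

lemma inner_normal_tangent: "lemniscate_normal u \<bullet> lemniscate_tangent u = 0"
  by (simp add: lemniscate_normal_def lemniscate_tangent_def)

text \<open>The curve is \<open>cos u * speed u * z\<close> and the normal is \<open>- z^3\<close>,
  so only the real part of \<open>z^2\<close>, namely \<open>(cos u * speed u)^2\<close>,
  enters.\<close>

lemma inner_lemniscate_normal: "lemniscate u \<bullet> lemniscate_normal u = - ((cos u * speed u) ^ 3)"
proof -
  have "cos u * (speed u)\<^sup>2 * - ((1 - 3 * (sin u)\<^sup>2) * speed u ^ 3) +
      sin u * cos u * (speed u)\<^sup>2 * - (sin u * (3 - (sin u)\<^sup>2) * speed u ^ 3)
      = - ((cos u * speed u) ^ 3)"
    using speed_relation[of u] sin_cos_squared_add[of u] by algebra
  then show ?thesis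
    by (simp add: lemniscate_def lemniscate_normal_def)
qed

section \<open>Curvature of the rescaled lemniscates\<close>

lemma vector_derivative_scaled_lemniscate:
  "vector_derivative (\<lambda>u. a *\<^sub>R lemniscate u) (at u) = (a * speed u) *\<^sub>R lemniscate_tangent u"
  using has_vector_derivative_scaleR[OF DERIV_const has_vector_derivative_lemniscate]
  by (intro vector_derivative_at) (simp add: mult.commute)

lemma arclength_deriv_scaled_lemniscate:
  assumes "a > 0" "(\<phi> has_vector_derivative v) (at u)"
  shows "arclength_deriv (\<lambda>u. a *\<^sub>R lemniscate u) \<phi> u = v /\<^sub>R (a * speed u)"
  using assms speed_pos[of u]
  by (simp add: arclength_deriv_def vector_derivative_scaled_lemniscate norm_lemniscate_tangent
      vector_derivative_at abs_mult)

lemma arclength_deriv_scaled_lemniscate_self: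
  assumes "a > 0"
  shows "arclength_deriv (\<lambda>u. a *\<^sub>R lemniscate u) (\<lambda>u. a *\<^sub>R lemniscate u) = lemniscate_tangent"
proof
  fix u
  show "arclength_deriv (\<lambda>u. a *\<^sub>R lemniscate u) (\<lambda>u. a *\<^sub>R lemniscate u) u = lemniscate_tangent u"
    using assms speed_pos[of u]
    by (simp add: arclength_deriv_def vector_derivative_scaled_lemniscate
        norm_lemniscate_tangent abs_mult divide_simps flip: divide_inverse)
qed

lemma curvature_scaled_lemniscate:
  assumes "a > 0"
  shows "curvature (\<lambda>u. a *\<^sub>R lemniscate u) lemniscate_normal = (\<lambda>u. 3 * cos u * speed u / a)"
proof
  fix u
  have "lemniscate_normal u \<bullet> lemniscate_normal u = 1"
    by (simp add: dot_square_norm norm_lemniscate_normal)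
  then show "curvature (\<lambda>u. a *\<^sub>R lemniscate u) lemniscate_normal u = 3 * cos u * speed u / a"
    using assms speed_pos[of u]
    by (simp add: curvature_def arclength_deriv_scaled_lemniscate_self
        arclength_deriv_scaled_lemniscate[OF _ has_vector_derivative_lemniscate_tangent]
        field_simps power2_eq_square)
qed

text \<open>The product rule gives \<open>- sin u * speed u ^ 3\<close> times
  \<open>1 + (sin u)^2 + (cos u)^2 = 2\<close>.\<close>

lemma has_real_derivative_cos_speed:
  "((\<lambda>u. cos u * speed u) has_real_derivative - 2 * sin u * speed u ^ 3) (at u)"
  apply (rule derivative_eq_intros has_real_derivative_speed refl)+
  apply simp
  using speed_relation[of u] sin_cos_squared_add[of u] apply algebra
  done

text \<open>The product rule gives \<open>cos u * speed u ^ 4\<close> times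
  \<open>1 + (sin u)^2 - 2 (sin u)^2 = (cos u)^2\<close>.\<close>

lemma has_real_derivative_sin_speed_square:
  "((\<lambda>u. sin u * (speed u)\<^sup>2) has_real_derivative cos u ^ 3 * speed u ^ 4) (at u)"
  apply (rule derivative_eq_intros has_real_derivative_speed refl)+
  apply simp
  using speed_relation[of u] sin_cos_squared_add[of u] apply algebra
  done

lemma curvature_s_scaled_lemniscate:
  assumes "a > 0"
  shows "arclength_deriv (\<lambda>u. a *\<^sub>R lemniscate u)
      (curvature (\<lambda>u. a *\<^sub>R lemniscate u) lemniscate_normal) = (\<lambda>u. - 6 * sin u * (speed u)\<^sup>2 / a\<^sup>2)"
proof
  fix u
  have "((\<lambda>u. 3 * cos u * speed u / a) has_real_derivative - 6 * sin u * speed u ^ 3 / a) (at u)"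
    using DERIV_cmult[OF has_real_derivative_cos_speed, of "3 / a" u] by (simp add: mult.assoc)
  then show "arclength_deriv (\<lambda>u. a *\<^sub>R lemniscate u)
      (curvature (\<lambda>u. a *\<^sub>R lemniscate u) lemniscate_normal) u = - 6 * sin u * (speed u)\<^sup>2 / a\<^sup>2"
    using assms speed_pos[of u]
    by (simp add: curvature_scaled_lemniscate arclength_deriv_scaled_lemniscate
        has_real_derivative_iff_has_vector_derivative field_simps power2_eq_square power3_eq_cube)
qed

text \<open>One factor \<open>1 / a\<close> comes from the curvature and one from each of the two
  arc-length derivatives.\<close>

lemma curvature_ss_scaled_lemniscate:
  assumes "a > 0"
  shows "arclength_deriv (\<lambda>u. a *\<^sub>R lemniscate u) (arclength_deriv (\<lambda>u. a *\<^sub>R lemniscate u)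
      (curvature (\<lambda>u. a *\<^sub>R lemniscate u) lemniscate_normal)) u = - 6 * (cos u * speed u) ^ 3 / a ^ 3"
proof -
  have "((\<lambda>u. - 6 * sin u * (speed u)\<^sup>2 / a\<^sup>2) has_real_derivative
      - 6 * cos u ^ 3 * speed u ^ 4 / a\<^sup>2) (at u)"
    using DERIV_cmult[OF has_real_derivative_sin_speed_square, of "- 6 / a\<^sup>2" u]
    by (simp add: mult.assoc)
  then show ?thesis
    using assms speed_pos[of u]
    by (simp add: curvature_s_scaled_lemniscate arclength_deriv_scaled_lemniscate
        has_real_derivative_iff_has_vector_derivative field_simps eval_nat_numeral)
qed

section \<open>Regularity and normal field of the rescaled lemniscates\<close>

lemma periodic_speed: "speed (u + 2 * pi) = speed u"
  by (simp add: speed_def)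

lemma regular_closed_curve_scaled_lemniscate:
  assumes "a > 0"
  shows "regular_closed_curve (\<lambda>u. a *\<^sub>R lemniscate u)"
  unfolding regular_closed_curve_def
proof (intro conjI allI)
  have "smooth (\<lambda>u. (a * (cos u * (speed u)\<^sup>2), a * (sin u * cos u * (speed u)\<^sup>2)))"
    by (intro smooth_trig_algebra_Pair trig_algebra_intros)
  then show "smooth (\<lambda>u. a *\<^sub>R lemniscate u)"
    by (simp add: lemniscate_def)
  show "periodic_2pi (\<lambda>u. a *\<^sub>R lemniscate u)"
    by (simp add: periodic_2pi_def lemniscate_def periodic_speed)
  fix u
  have "lemniscate_tangent u \<noteq> 0"
    using norm_lemniscate_tangent[of u] by auto
  then show "vector_derivative (\<lambda>u. a *\<^sub>R lemniscate u) (at u) \<noteq> 0"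
    using assms speed_pos[of u] by (simp add: vector_derivative_scaled_lemniscate)
qed

text \<open>Scaling preserves tangent lines, so one field serves all time slices.\<close>

lemma unit_normal_field_scaled_lemniscate:
  "unit_normal_field (\<lambda>u. a *\<^sub>R lemniscate u) lemniscate_normal"
  unfolding unit_normal_field_def
proof (intro conjI allI)
  show "smooth lemniscate_normal"
    unfolding lemniscate_normal_def[abs_def]
    by (intro smooth_trig_algebra_Pair trig_algebra_intros)
  show "periodic_2pi lemniscate_normal"
    by (simp add: periodic_2pi_def lemniscate_normal_def periodic_speed)
qed (simp_all add: norm_lemniscate_normal vector_derivative_scaled_lemniscate inner_normal_tangent)

section \<open>The scaling factor and the flow\<close>

text \<open>Differentiating \<open>f^4 = 1 - 24 t\<close> gives
  \<open>4 f^3 f' = - 24\<close>.\<close>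

lemma has_real_derivative_fourth_root_scale:
  assumes "t < 1 / 24"
  shows "((\<lambda>t. sqrt (sqrt (1 - 24 * t))) has_real_derivative
    - 6 / sqrt (sqrt (1 - 24 * t)) ^ 3) (at t)"
proof -
  have "((\<lambda>t. sqrt (sqrt (1 - 24 * t))) has_real_derivative
      inverse (sqrt (sqrt (1 - 24 * t))) / 2 * (inverse (sqrt (1 - 24 * t)) / 2 * (- 24))) (at t)"
    using assms by (auto intro!: derivative_eq_intros)
  moreover have "sqrt (sqrt (1 - 24 * t)) ^ 3 = sqrt (sqrt (1 - 24 * t)) * sqrt (1 - 24 * t)"
    using assms by (simp add: power3_eq_cube)
  ultimately show ?thesis
    using assms by (simp add: field_simps)
qed

theorem proposition13:
  fixes \<gamma> :: "real \<Rightarrow> real \<times> real"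
  assumes "\<And>u. \<gamma> u = (1 / (1 + (sin u)\<^sup>2)) *\<^sub>R (cos u, 1 / 2 * sin (2 * u))"
  shows "evolves_homothetically \<gamma>"
proof -
  have \<gamma>: "\<gamma> = lemniscate"
    using assms by (simp add: fun_eq_iff lemniscate_def speed_square sin_double)
  \<comment> \<open>This factor reaches zero at \<open>t = 1 / 24\<close>, hence the choice of the
    time interval.\<close>
  define f :: "real \<Rightarrow> real" where "f t = sqrt (sqrt (1 - 24 * t))" for t
  have f_pos: "f t > 0" if "t \<in> {0..<1/24}" for t
    using that by (simp add: f_def)
  have f_deriv: "(f has_real_derivative - 6 / f t ^ 3) (at t within {0..<1/24})"
    if "t \<in> {0..<1/24}" for t
    using has_real_derivative_fourth_root_scale[of t] that
    unfolding f_def[abs_def] by (auto intro: has_field_derivative_at_within)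
  have "curve_diffusion_flow (1/24) (\<lambda>u t. f t *\<^sub>R \<gamma> u)"
    unfolding curve_diffusion_flow_def
  proof (intro ballI conjI)
    fix t :: real assume t: "t \<in> {0..<1/24}"
    show "regular_closed_curve (\<lambda>u. f t *\<^sub>R \<gamma> u)"
      unfolding \<gamma> by (rule regular_closed_curve_scaled_lemniscate[OF f_pos[OF t]])
    show "\<exists>\<nu>. unit_normal_field (\<lambda>u. f t *\<^sub>R \<gamma> u) \<nu> \<and>
      (\<forall>u. \<exists>v. ((\<lambda>\<tau>. f \<tau> *\<^sub>R \<gamma> u) has_vector_derivative v) (at t within {0..<1/24}) \<and>
        v \<bullet> \<nu> u = - arclength_deriv (\<lambda>u. f t *\<^sub>R \<gamma> u)
          (arclength_deriv (\<lambda>u. f t *\<^sub>R \<gamma> u) (curvature (\<lambda>u. f t *\<^sub>R \<gamma> u) \<nu>)) u)"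
      unfolding \<gamma>
    proof (intro exI[of _ lemniscate_normal] conjI allI unit_normal_field_scaled_lemniscate)
      fix u
      show "\<exists>v. ((\<lambda>\<tau>. f \<tau> *\<^sub>R lemniscate u) has_vector_derivative v) (at t within {0..<1/24}) \<and>
        v \<bullet> lemniscate_normal u = - arclength_deriv (\<lambda>u. f t *\<^sub>R lemniscate u)
          (arclength_deriv (\<lambda>u. f t *\<^sub>R lemniscate u)
            (curvature (\<lambda>u. f t *\<^sub>R lemniscate u) lemniscate_normal)) u"
        \<comment> \<open>The velocity is \<open>f'(t)\<close> times the initial point. Its normal
          component is \<open>6 * (cos u * speed u)^3 / f t ^ 3\<close>, the negative of the second
          arc-length derivative of the curvature at scale \<open>f t\<close>.\<close>
        using has_vector_derivative_scaleR[OF f_deriv[OF t] has_vector_derivative_const]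
        by (intro exI[of _ "(- 6 / f t ^ 3) *\<^sub>R lemniscate u"])
          (simp add: curvature_ss_scaled_lemniscate[OF f_pos[OF t]] inner_lemniscate_normal)
    qed
  qed
  moreover have "f differentiable_on {0..<1/24}"
    unfolding differentiable_on_def
    using f_deriv by (meson has_field_derivative_imp_has_derivative differentiableI)
  ultimately show ?thesis
    unfolding evolves_homothetically_def
    using f_pos by (intro exI[of _ "1/24"] exI[of _ f] conjI) (auto simp: f_def)
qed

end
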